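(* Let $\nu$ be a positive integer. If $\zeta^{(\nu)}_0(s)=0$, $\mathrm{Re}(s)\le\nu$ and $s\neq 1,2,\ldots,\nu$, then $s\in\mathbb{Z}_{<0}$, i.e. $s$ is a negative integer.
   Context: For $0<q<1$ write $[n]_q=(1-q^n)/(1-q)$ and $q^x=e^{x\log q}$. For a positive integer $\nu$, $$\zeta^{(\nu)}_q(s)=\sum_{n=1}^{\infty}\frac{q^{n(s-\nu)}}{[n]_q^{\,s}}\qquad(\mathrm{Re}(s)>\nu),$$ and the same symbol denotes its meromorphic continuation to $s\in\mathbb{C}$. The crystal Riemann zeta function of type $\nu$ is the pointwise limit $\zeta^{(\nu)}_0(s)=\lim_{q\downarrow0}\zeta^{(\nu)}_q(s)$, defined at those $s$ where the limit exists; the condition $\zeta^{(\nu)}_0(s)=0$ means that the limit exists at $s$ and equals $0$. *)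

theory Defs
  imports "HOL-Complex_Analysis.Complex_Analysis"
begin

definition q_bracket :: "real \<Rightarrow> nat \<Rightarrow> real" where
  "q_bracket q n = (1 - q ^ n) / (1 - q)"

(* For 0 < q < 1 both bases are positive reals, so the principal branch used by powr
   gives q^x = exp (x * ln q). The summation index n \<ge> 1 is written as Suc k. *)
definition q_zeta_series :: "nat \<Rightarrow> real \<Rightarrow> complex \<Rightarrow> complex" where
  "q_zeta_series \<nu> q s =
     (\<Sum>k. of_real q powr (of_nat (Suc k) * (s - of_nat \<nu>)) /
           of_real (q_bracket q (Suc k)) powr s)"

(* nicely_meromorphic_on fixes the values of a meromorphic function at removable
   singularities (by continuity) and at poles (by the value 0), which makes the
   meromorphic continuation unique as a total function. *)
definition q_zeta :: "nat \<Rightarrow> real \<Rightarrow> complex \<Rightarrow> complex" where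
  "q_zeta \<nu> q =
     (THE f. f nicely_meromorphic_on UNIV \<and>
             (\<forall>s. Re s > real \<nu> \<longrightarrow> f s = q_zeta_series \<nu> q s))"

(* The parameters q at which the continued function has a genuine value at s;
   the conventional value 0 at a pole must play no role in the limit below. *)
definition q_zeta_domain :: "nat \<Rightarrow> complex \<Rightarrow> real set" where
  "q_zeta_domain \<nu> s = {q. 0 < q \<and> q < 1 \<and> \<not> is_pole (q_zeta \<nu> q) s}"

(* "The limit of q_zeta \<nu> q s as q tends to 0 from above exists and equals L".
   The islimpt condition excludes a vacuous limit where s is a pole for all small q. *)
definition has_crystal_zeta :: "nat \<Rightarrow> complex \<Rightarrow> complex \<Rightarrow> bool" where
  "has_crystal_zeta \<nu> s L \<longleftrightarrow>
     0 islimpt q_zeta_domain \<nu> s \<and>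
     ((\<lambda>q. q_zeta \<nu> q s) \<longlongrightarrow> L) (at 0 within q_zeta_domain \<nu> s)"

end

theory Submission
  imports Defs
begin

text \<open>
  Write $w_k = s - \nu + k$ and $b_k(s) = s(s+1)\cdots(s+k-1)/k!$. Expanding
  $(1-q^n)^{-s} = \sum_k b_k(s)\, q^{nk}$ in the defining series and summing over $n$ first turns
  the $k$-th part into $b_k(s)\,g(q^{w_k})$, where $g(e) = e/(1-e)$ makes sense for all $e \neq 1$.
  It is enough to expand to order $K$: the remainder, the sum over $n$ of
  $q^{n(s-\nu)} \left((1-q^n)^{-s} - \sum_{k<K} b_k(s) q^{nk}\right)$, converges locally uniformly
  for $\mathrm{Re}(s) > \nu - K$, so
  \[ \zeta_q(s) = (1-q)^s \left(\sum_{k<K} b_k(s)\, g(q^{w_k}) + R_K(s)\right) \]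
  there (lemmas \<open>q_zeta_form_0\<close>, \<open>q_zeta_form_mono\<close> and \<open>q_zeta_eq_remove_sings\<close>). Formulas for
  different $K$ differ by a geometric series, so no interchange of double sums is needed
  to glue them into the meromorphic continuation.

  As $q$ tends to $0$, the remainder tends to $0$ and $g(q^{w})$ tends to $-1$ when
  $\mathrm{Re}(w) < 0$. Let $m$ be the integer part of $\nu - \mathrm{Re}(s) \ge 0$ and take
  $K = m + 1$, so that exactly the terms $k \le m$ have $\mathrm{Re}(w_k) \le 0$, with equality at
  most for $k = m$.

  \<^item> If $\mathrm{Re}(w_m) < 0$, the limit is $-\sum_{k \le m} b_k(s) = -b_m(s+1)$, which vanishes
    only at $s = -1, \ldots, -m$ (lemma \<open>crystal_zeta_generic\<close>).

  \<^item> If $\mathrm{Re}(w_m) = 0$ but $s$ is not real, then $q^{w_m}$ runs round the unit circle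
    infinitely often while its coefficient $b_m(s)$ is nonzero, so there is no limit
    (lemma \<open>crystal_zeta_critical_line\<close>).

  \<^item> Otherwise $s = \nu - m$ is an integer; the positive ones are excluded by hypothesis. At $s = 0$
    the zero of $b_\nu$ cancels the pole of $g(q^{w_\nu})$ and leaves $-1/(\nu \log q)$, which tends
    to $0$, so the limit is $-1$ (lemma \<open>crystal_zeta_at_0\<close>). Only negative integers remain.
\<close>

section \<open>Coefficients and remainders of the negative binomial series\<close>

definition neg_binom :: "'a :: field_char_0 \<Rightarrow> nat \<Rightarrow> 'a" where
  "neg_binom s k = pochhammer s k / fact k"

lemma neg_binom_0 [simp]: "neg_binom s 0 = 1"
  by (simp add: neg_binom_def)

lemma neg_binom_zero_left: "neg_binom 0 k = (if k = 0 then 1 else 0)"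
  by (simp add: neg_binom_def pochhammer_0_left)

text \<open>
  Both sides are the coefficient of $x^m$ in $(1-x)^{-s} \cdot (1-x)^{-1} = (1-x)^{-(s+1)}$.
\<close>
lemma sum_neg_binom:
  fixes s :: "'a :: field_char_0"
  shows "(\<Sum>k\<le>m. neg_binom s k) = neg_binom (s + 1) m"
proof (induction m)
  case (Suc m)
  have "neg_binom (s + 1) m + neg_binom s (Suc m) =
        pochhammer (s + 1) m * (of_nat (Suc m) + s) / fact (Suc m)"
    using of_nat_neq_0[of m, where ?'a = 'a]
    by (simp add: neg_binom_def pochhammer_rec divide_simps del: of_nat_Suc)
       (simp add: algebra_simps)
  also have "\<dots> = neg_binom (s + 1) (Suc m)"
    by (simp add: neg_binom_def pochhammer_rec' algebra_simps)
  finally show ?case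
    using Suc by simp
qed simp

lemma neg_binom_eq_0_iff: "neg_binom s m = 0 \<longleftrightarrow> (\<exists>k<m. s = - of_nat k)"
  by (simp add: neg_binom_def pochhammer_eq_0_iff)

lemma holomorphic_neg_binom [holomorphic_intros]: "(\<lambda>s. neg_binom s k) holomorphic_on A"
  unfolding neg_binom_def pochhammer_prod by (intro holomorphic_intros) auto

lemma norm_neg_binom_le:
  fixes s :: complex
  assumes "norm s \<le> R"
  shows "norm (neg_binom s k) \<le> neg_binom R k"
proof -
  have "norm (s + of_nat i) \<le> R + of_nat i" for i
    using norm_triangle_ineq[of s "of_nat i"] assms by simp
  thus ?thesis
    unfolding neg_binom_def pochhammer_prod norm_divide prod_norm[symmetric] norm_fact
    by (intro divide_right_mono prod_mono) auto
qed

lemma neg_binom_series: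
  fixes s :: complex
  assumes "\<bar>x\<bar> < 1"
  shows "(\<lambda>k. neg_binom s k * of_real x ^ k) sums (of_real (1 - x) powr (- s))"
proof -
  have "(\<lambda>k. (- s gchoose k) * (- of_real x) ^ k) sums (1 + - of_real x) powr (- s)"
    using assms by (intro gen_binomial_complex) simp
  moreover have "(- s gchoose k) * (- of_real x) ^ k = neg_binom s k * of_real x ^ k" for k
  proof -
    have "(- s gchoose k) * (- of_real x) ^ k
          = ((- 1) ^ k * (- 1) ^ k) * (neg_binom s k * of_real x ^ k)"
      by (simp add: gbinomial_pochhammer neg_binom_def power_minus[of "of_real x"])
    also have "((- 1) ^ k * (- 1) ^ k :: complex) = 1"
      by (simp add: power_mult_distrib[symmetric])
    finally show ?thesis by simp
  qed
  ultimately show ?thesis by simp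
qed

definition binom_remainder :: "nat \<Rightarrow> complex \<Rightarrow> real \<Rightarrow> complex" where
  "binom_remainder K s x = of_real (1 - x) powr (- s) - (\<Sum>k<K. neg_binom s k * of_real x ^ k)"

text \<open>
  The bound is uniform in both variables: $s$ enters only through its norm, because
  $|b_k(s)| \le b_k(R)$, and the power $x^K$ can be factored out of the tail
  $\sum_{k \ge K} b_k(R)\, x^k$ with a constant that depends only on the largest $x$ allowed.
  The first uniformity gives holomorphy in $s$, the second the limit $q \to 0$.
\<close>
lemma binom_remainder_bound:
  fixes r R :: real
  assumes "0 < r" "r < 1"
  obtains C where "C \<ge> 0" "\<And>s x. norm s \<le> R \<Longrightarrow> 0 < x \<Longrightarrow> x \<le> r \<Longrightarrow>
                             norm (binom_remainder K s x) \<le> C * x ^ K"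
proof (cases "R \<ge> 0")
  case False
  hence "\<not> norm s \<le> R" for s :: complex
    using norm_ge_zero[of s] by linarith
  thus ?thesis using that[of 0] by auto
next
  case True
  define f where "f j = neg_binom R (j + K) * r ^ j" for j
  have nonneg: "neg_binom R k \<ge> 0" for k
    using True by (auto simp: neg_binom_def pochhammer_prod intro!: divide_nonneg_nonneg prod_nonneg)
  have "summable (\<lambda>k. complex_of_real (neg_binom R k * r ^ k))"
    using neg_binom_series[of r "of_real R"] assms
    by (simp add: sums_iff neg_binom_def pochhammer_of_real)
  hence "summable (\<lambda>k. neg_binom R k * r ^ k)"
    by (simp only: summable_complex_of_real)
  hence "summable (\<lambda>k. neg_binom R (k + K) * r ^ (k + K))"
    by (subst summable_iff_shift)
  from summable_mult[OF this, of "inverse (r ^ K)"] have f: "summable f"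
    unfolding f_def using assms by (simp add: power_add field_simps)
  show ?thesis
  proof (rule that[of "suminf f"])
    show "suminf f \<ge> 0"
      using f nonneg assms by (intro suminf_nonneg) (auto simp: f_def)
  next
    fix s :: complex and x :: real
    assume s: "norm s \<le> R" and x: "0 < x" "x \<le> r"
    have rem: "(\<lambda>k. neg_binom s (k + K) * of_real x ^ (k + K)) sums binom_remainder K s x"
      using sums_split_initial_segment[OF neg_binom_series[of x s], of K] x assms
      by (simp add: binom_remainder_def)
    have bnd: "norm (neg_binom s (k + K) * of_real x ^ (k + K)) \<le> x ^ K * f k" for k
    proof -
      have "norm (neg_binom s (k + K) * of_real x ^ (k + K))
            = norm (neg_binom s (k + K)) * (x ^ k * x ^ K)"
        using x by (simp add: norm_mult norm_power power_add)
      also have "\<dots> \<le> neg_binom R (k + K) * (r ^ k * x ^ K)"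
        using x s nonneg by (intro mult_mono norm_neg_binom_le power_mono) auto
      finally show ?thesis by (simp add: f_def mult_ac)
    qed
    have "(\<lambda>k. x ^ K * f k) sums (x ^ K * suminf f)"
      using f by (intro sums_mult summable_sums)
    from norm_sums_le[OF rem this bnd]
    have "norm (binom_remainder K s x) \<le> x ^ K * suminf f" .
    thus "norm (binom_remainder K s x) \<le> suminf f * x ^ K"
      by (simp add: mult_ac)
  qed
qed


section \<open>The remainder series\<close>

lemma of_real_powr_eq_exp:
  "q > 0 \<Longrightarrow> complex_of_real q powr w = exp (w * of_real (ln q))"
  by (simp add: powr_def Ln_of_real)

lemma norm_of_real_powr:
  "q > 0 \<Longrightarrow> norm (complex_of_real q powr w) = q powr Re w"
  by (simp add: norm_powr_real_powr)

lemma of_real_powr_shift: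
  assumes "q > 0"
  shows "complex_of_real q powr (of_nat n * w) * of_real (q ^ n) ^ K = (of_real q powr (w + of_nat K)) ^ n"
proof -
  have "complex_of_real q ^ n ^ 1 = exp (of_nat n * of_real (ln q))"
    using assms by (simp add: exp_of_nat_mult exp_of_real)
  thus ?thesis
    using assms
    by (simp add: of_real_powr_eq_exp exp_of_nat_mult [symmetric] exp_add [symmetric] algebra_simps)
qed

text \<open>
  For $|e| < 1$ this is the sum of $e^n$ over $n \ge 1$; elsewhere it is the continuation of that sum.
\<close>
definition geom_value :: "complex \<Rightarrow> complex" where
  "geom_value e = e / (1 - e)"

lemma geom_value_sums: "norm e < 1 \<Longrightarrow> (\<lambda>n. e ^ Suc n) sums geom_value e"
  using sums_mult[OF geometric_sums[of e], of e] by (simp add: geom_value_def)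

definition q_tail_term :: "nat \<Rightarrow> nat \<Rightarrow> real \<Rightarrow> complex \<Rightarrow> nat \<Rightarrow> complex" where
  "q_tail_term \<nu> K q s n =
     of_real q powr (of_nat (Suc n) * (s - of_nat \<nu>)) * binom_remainder K s (q ^ Suc n)"

definition q_tail :: "nat \<Rightarrow> nat \<Rightarrow> real \<Rightarrow> complex \<Rightarrow> complex" where
  "q_tail \<nu> K q s = (\<Sum>n. q_tail_term \<nu> K q s n)"

lemma q_tail_term_bound:
  fixes r R :: real
  assumes "0 < r" "r < 1"
  obtains C where "C \<ge> 0"
    "\<And>q s n. norm s \<le> R \<Longrightarrow> 0 < q \<Longrightarrow> q \<le> r \<Longrightarrow>
       norm (q_tail_term \<nu> K q s n) \<le> C * (q powr (Re s - real \<nu> + real K)) ^ Suc n"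
proof -
  obtain C where C: "C \<ge> 0"
    "\<And>s x. norm s \<le> R \<Longrightarrow> 0 < x \<Longrightarrow> x \<le> r \<Longrightarrow> norm (binom_remainder K s x) \<le> C * x ^ K"
    using binom_remainder_bound[OF assms] by metis
  show ?thesis
  proof (rule that[OF C(1)])
    fix q :: real and s :: complex and n :: nat
    assume *: "norm s \<le> R" "0 < q" "q \<le> r"
    have "q ^ Suc n \<le> q ^ 1"
      using * assms by (intro power_decreasing) auto
    hence "norm (binom_remainder K s (q ^ Suc n)) \<le> C * (q ^ Suc n) ^ K"
      using * by (intro C) (auto simp del: power_Suc)
    hence "norm (q_tail_term \<nu> K q s n)
             \<le> norm (complex_of_real q powr (of_nat (Suc n) * (s - of_nat \<nu>))) * (C * (q ^ Suc n) ^ K)"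
      unfolding q_tail_term_def norm_mult by (rule mult_left_mono) simp
    also have "\<dots> = C * norm (of_real q powr (of_nat (Suc n) * (s - of_nat \<nu>)) * of_real (q ^ Suc n) ^ K)"
      using * by (simp add: norm_mult norm_power)
    also have "norm (of_real q powr (of_nat (Suc n) * (s - of_nat \<nu>)) * of_real (q ^ Suc n) ^ K)
                     = (q powr (Re s - real \<nu> + real K)) ^ Suc n"
      by (subst of_real_powr_shift) (use * in \<open>auto simp: norm_power norm_mult norm_of_real_powr\<close>)
    finally show "norm (q_tail_term \<nu> K q s n) \<le> C * (q powr (Re s - real \<nu> + real K)) ^ Suc n" .
  qed
qed

lemma powr_less_one_iff': "0 < q \<Longrightarrow> q < 1 \<Longrightarrow> q powr x < 1 \<longleftrightarrow> x > (0::real)"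
  by (smt (verit) powr_less_cancel_iff powr_less_mono' powr_zero_eq_one)

lemma q_tail_summable_and_bound:
  fixes r R :: real
  assumes "0 < r" "r < 1"
  obtains C where
    "\<And>q s. norm s \<le> R \<Longrightarrow> 0 < q \<Longrightarrow> q \<le> r \<Longrightarrow> Re s > real \<nu> - real K \<Longrightarrow>
       summable (q_tail_term \<nu> K q s) \<and>
       norm (q_tail \<nu> K q s) \<le> C * (q powr (Re s - real \<nu> + real K) / (1 - q powr (Re s - real \<nu> + real K)))"
proof -
  obtain C where C: "C \<ge> 0"
    "\<And>q s n. norm s \<le> R \<Longrightarrow> 0 < q \<Longrightarrow> q \<le> r \<Longrightarrow>
       norm (q_tail_term \<nu> K q s n) \<le> C * (q powr (Re s - real \<nu> + real K)) ^ Suc n"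
    using q_tail_term_bound[OF assms] by metis
  show ?thesis
  proof (rule that[of C])
    fix q :: real and s :: complex
    assume *: "norm s \<le> R" "0 < q" "q \<le> r" "Re s > real \<nu> - real K"
    define y where "y = q powr (Re s - real \<nu> + real K)"
    have y: "0 < y" "y < 1"
      using * assms by (auto simp: y_def powr_less_one_iff')
    have geo: "(\<lambda>n. C * y ^ Suc n) sums (C * (y / (1 - y)))"
      using sums_mult[OF sums_mult[OF geometric_sums[of y], of y], of C] y by simp
    have bnd: "norm (q_tail_term \<nu> K q s n) \<le> C * y ^ Suc n" for n
      using C(2)[OF *(1-3), of n] by (simp add: y_def)
    have summ: "summable (q_tail_term \<nu> K q s)"
      by (rule summable_comparison_test'[OF sums_summable[OF geo] bnd])
    have "norm (q_tail \<nu> K q s) \<le> C * (y / (1 - y))"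
      unfolding q_tail_def by (rule norm_sums_le[OF summable_sums[OF summ] geo bnd])
    thus "summable (q_tail_term \<nu> K q s) \<and>
       norm (q_tail \<nu> K q s) \<le> C * (q powr (Re s - real \<nu> + real K) / (1 - q powr (Re s - real \<nu> + real K)))"
      using summ by (simp add: y_def)
  qed
qed

lemma q_tail_sums:
  assumes "0 < q" "q < 1" "Re s > real \<nu> - real K"
  shows "q_tail_term \<nu> K q s sums q_tail \<nu> K q s"
proof -
  obtain C where
    "\<And>p z. norm z \<le> norm s \<Longrightarrow> 0 < p \<Longrightarrow> p \<le> q \<Longrightarrow> Re z > real \<nu> - real K \<Longrightarrow>
       summable (q_tail_term \<nu> K p z) \<and>
       norm (q_tail \<nu> K p z) \<le> C * (p powr (Re z - real \<nu> + real K) / (1 - p powr (Re z - real \<nu> + real K)))"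
    using q_tail_summable_and_bound[OF assms(1,2)] by metis
  from this[of s q] assms show ?thesis
    by (simp add: q_tail_def summable_sums)
qed

lemma binom_remainder_Suc:
  "binom_remainder K s x = binom_remainder (Suc K) s x + neg_binom s K * of_real x ^ K"
  by (simp add: binom_remainder_def)

text \<open>
  The coefficient of order $K$ contributes $b_K(s)\, q^{n w_K}$ to the $n$-th term, and $|q^{w_K}| < 1$
  in the half-plane where the series is considered.
\<close>
lemma q_tail_Suc:
  assumes q: "0 < q" "q < 1" and s: "Re s > real \<nu> - real K"
  shows "q_tail \<nu> K q s =
           q_tail \<nu> (Suc K) q s + neg_binom s K * geom_value (of_real q powr (s - of_nat \<nu> + of_nat K))"
proof -
  define e where "e = complex_of_real q powr (s - of_nat \<nu> + of_nat K)"
  have "norm e < 1"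
    using q s by (simp add: e_def norm_of_real_powr powr_less_one_iff')
  from sums_mult[OF geom_value_sums[OF this], of "neg_binom s K"]
  have "(\<lambda>n. q_tail_term \<nu> (Suc K) q s n + neg_binom s K * e ^ Suc n) sums
          (q_tail \<nu> (Suc K) q s + neg_binom s K * geom_value e)"
    using q s by (intro sums_add q_tail_sums) auto
  moreover have "q_tail_term \<nu> (Suc K) q s n + neg_binom s K * e ^ Suc n = q_tail_term \<nu> K q s n" for n
  proof -
    have "e ^ Suc n = of_real q powr (of_nat (Suc n) * (s - of_nat \<nu>)) * of_real (q ^ Suc n) ^ K"
      unfolding e_def by (rule of_real_powr_shift [symmetric]) (use q in auto)
    thus ?thesis
      by (simp add: q_tail_term_def binom_remainder_Suc[of K] distrib_left mult_ac)
  qed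
  ultimately show ?thesis
    using q_tail_sums[OF q s] by (simp add: e_def sums_iff)
qed

lemma open_Re_greater: "open {s. Re s > c}"
  by (intro open_Collect_less continuous_intros)

lemma q_tail_holomorphic:
  assumes q: "0 < q" "q < 1"
  shows "q_tail \<nu> K q holomorphic_on {s. Re s > real \<nu> - real K}"
proof -
  define S where "S = {s. Re s > real \<nu> - real K}"
  have S: "open S" unfolding S_def by (rule open_Re_greater)
  have hol: "(\<lambda>s. q_tail_term \<nu> K q s n) holomorphic_on S" for n
    unfolding q_tail_term_def binom_remainder_def using q power_less_one_iff[of q "Suc n"]
    by (intro holomorphic_intros) auto
  obtain g where g: "\<forall>s\<in>S. (\<lambda>n. q_tail_term \<nu> K q s n) sums g s \<and> g field_differentiable (at s)"
  proof (rule series_differentiable_comparison_complex[OF S])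
    fix n s assume "s \<in> S"
    thus "(\<lambda>s. q_tail_term \<nu> K q s n) field_differentiable (at s)"
      using holomorphic_on_imp_differentiable_at[OF hol S] by blast
  next
    fix s assume s: "s \<in> S"
    \<comment> \<open>Half the distance to the boundary line: on the ball of radius $d$ the $n$-th term is at most
      $C q^{nd}$.\<close>
    define d where "d = (Re s - real \<nu> + real K) / 2"
    have d: "d > 0" using s by (simp add: d_def S_def)
    obtain C where C: "C \<ge> 0"
      "\<And>p z n. norm z \<le> norm s + d \<Longrightarrow> 0 < p \<Longrightarrow> p \<le> q \<Longrightarrow>
         norm (q_tail_term \<nu> K p z n) \<le> C * (p powr (Re z - real \<nu> + real K)) ^ Suc n"
      using q_tail_term_bound[OF q] by metis
    define y where "y = q powr d"
    have y: "0 < y" "y < 1" using q d by (auto simp: y_def powr_less_one_iff')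
    define h where "h n = complex_of_real (C * y ^ Suc n)" for n
    have "summable h"
      unfolding h_def summable_complex_of_real using y by (intro summable_mult) (simp add: summable_mult)
    moreover have "range h \<subseteq> \<real>\<^sub>\<ge>\<^sub>0"
      using C(1) y by (auto simp: h_def)
    moreover have "norm (q_tail_term \<nu> K q z n) \<le> norm (h n)" if z: "z \<in> ball s d \<inter> S" for z n
    proof -
      have "norm z \<le> norm s + norm (z - s)" "\<bar>Re (z - s)\<bar> \<le> norm (z - s)" "norm (z - s) < d"
        using norm_triangle_ineq[of s "z - s"] abs_Re_le_cmod[of "z - s"] z
        by (auto simp: dist_norm norm_minus_commute)
      hence z': "norm z \<le> norm s + d" "Re z - real \<nu> + real K \<ge> d"
        by (auto simp: d_def field_simps)
      have "norm (q_tail_term \<nu> K q z n) \<le> C * (q powr (Re z - real \<nu> + real K)) ^ Suc n"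
        using z' q by (intro C) auto
      also have "\<dots> \<le> C * y ^ Suc n"
        unfolding y_def using z' q C(1)
        by (intro mult_left_mono power_mono powr_mono') auto
      finally show ?thesis
        using C(1) y by (simp add: h_def norm_mult norm_power)
    qed
    ultimately show "\<exists>d (h :: nat \<Rightarrow> complex). 0 < d \<and> summable h \<and> range h \<subseteq> \<real>\<^sub>\<ge>\<^sub>0 \<and>
        (\<forall>\<^sub>F n in sequentially. \<forall>z\<in>ball s d \<inter> S. norm (q_tail_term \<nu> K q z n) \<le> norm (h n))"
      using d by (intro exI[of _ d] exI[of _ h]) auto
  qed blast
  have "g holomorphic_on S"
    using g by (simp add: holomorphic_on_def field_differentiable_at_within)
  moreover have "g s = q_tail \<nu> K q s" if "s \<in> S" for s
    using g that by (auto simp: q_tail_def sums_iff)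
  ultimately show ?thesis
    unfolding S_def using holomorphic_cong by metis
qed


section \<open>The meromorphic continuation\<close>

text \<open>
  The identity theorem for meromorphic functions. It makes the two functions agree on a punctured
  neighbourhood of every point; the conventions for the values at removable singularities and at
  poles then force equality at the point itself.
\<close>
lemma nicely_meromorphic_eqI:
  assumes f: "f nicely_meromorphic_on UNIV" and g: "g nicely_meromorphic_on UNIV"
    and U: "open U" "U \<noteq> {}" "\<And>z. z \<in> U \<Longrightarrow> f z = g z"
  shows "f = g"
proof
  fix z
  define h where "h w = f w - g w" for w
  have h: "h meromorphic_on UNIV"
    using f g unfolding h_def nicely_meromorphic_on_def by (intro meromorphic_intros) auto
  obtain u where u: "u \<in> U" using U by blast
  \<comment> \<open>Near every point close to $u$ the difference vanishes, so its normalised form is $0$ there.\<close>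
  have "\<forall>\<^sub>F w in nhds u. w \<in> U"
    using U u by (intro eventually_nhds_in_open)
  hence "\<forall>\<^sub>F w in nhds u. \<forall>\<^sub>F v in nhds w. v \<in> U"
    by (simp add: eventually_eventually)
  hence "\<forall>\<^sub>F w in nhds u. remove_sings h w = 0"
  proof eventually_elim
    case (elim w)
    hence "\<forall>\<^sub>F v in at w. h v = 0"
      using U by (auto simp: h_def eventually_at_filter elim!: eventually_mono)
    thus ?case
      by (intro remove_sings_eqI tendsto_eventually)
  qed
  hence "\<forall>\<^sub>F w in at u. remove_sings h w = 0"
    by (simp add: eventually_at_filter eventually_mono)
  hence "\<exists>\<^sub>F w in at u. remove_sings h w = 0"
    by (intro eventually_frequently) auto
  from frequently_eq_meromorphic_imp_constant[OF this remove_sings_nicely_meromorphic[OF h]]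
  have zero: "remove_sings h w = 0" for w by auto
  have "isolated_singularity_at h z"
    using h by (intro meromorphic_on_isolated_singularity meromorphic_on_subset[OF h]) auto
  from eventually_remove_sings_eq_at[OF this] have ev: "\<forall>\<^sub>F w in at z. f w = g w"
    by eventually_elim (simp add: zero h_def)
  have pole: "is_pole f z \<longleftrightarrow> is_pole g z"
    using ev by (intro is_pole_cong) auto
  have "(is_pole f z \<and> f z = 0) \<or> f \<midarrow>z\<rightarrow> f z" "(is_pole g z \<and> g z = 0) \<or> g \<midarrow>z\<rightarrow> g z"
    using f g by (auto simp: nicely_meromorphic_on_def)
  moreover have "\<not> (is_pole f z \<and> f \<midarrow>z\<rightarrow> c)" for f :: "complex \<Rightarrow> complex" and c
    unfolding is_pole_def by (meson at_neq_bot not_tendsto_and_filterlim_at_infinity)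
  moreover have "f \<midarrow>z\<rightarrow> c \<longleftrightarrow> g \<midarrow>z\<rightarrow> c" for c
    using ev by (intro filterlim_cong) auto
  ultimately show "f z = g z"
    using pole LIM_unique by metis
qed

text \<open>
  The continuation of the zeta function to the half-plane $\mathrm{Re}(s) > \nu - K$.
\<close>
definition q_zeta_form :: "nat \<Rightarrow> nat \<Rightarrow> real \<Rightarrow> complex \<Rightarrow> complex" where
  "q_zeta_form \<nu> K q s = of_real (1 - q) powr s *
     ((\<Sum>k<K. neg_binom s k * geom_value (of_real q powr (s - of_nat \<nu> + of_nat k))) + q_tail \<nu> K q s)"

lemma q_zeta_form_mono:
  assumes "0 < q" "q < 1" "Re s > real \<nu> - real K" "K \<le> L"
  shows "q_zeta_form \<nu> L q s = q_zeta_form \<nu> K q s"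
  using assms(4)
proof (induction L rule: dec_induct)
  case (step L)
  have "q_tail \<nu> L q s = q_tail \<nu> (Suc L) q s +
          neg_binom s L * geom_value (of_real q powr (s - of_nat \<nu> + of_nat L))"
    using assms step by (intro q_tail_Suc) auto
  thus ?case
    using step by (simp add: q_zeta_form_def add_ac)
qed simp

lemma q_zeta_form_0:
  assumes q: "0 < q" "q < 1" and s: "Re s > real \<nu>"
  shows "q_zeta_form \<nu> 0 q s = q_zeta_series \<nu> q s"
proof -
  have "of_real (1 - q) powr s * q_tail_term \<nu> 0 q s k =
        of_real q powr (of_nat (Suc k) * (s - of_nat \<nu>)) / of_real (q_bracket q (Suc k)) powr s" for k
  proof -
    have *: "q ^ Suc k < 1"
      using q by (simp add: power_less_one_iff del: power_Suc)
    hence "of_real (q_bracket q (Suc k)) powr s = of_real (1 - q ^ Suc k) powr s / of_real (1 - q) powr s"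
      using q by (simp add: of_real_powr_eq_exp q_bracket_def ln_div
                       del: power_Suc of_real_diff of_real_divide)
         (simp only: of_real_diff right_diff_distrib exp_diff)
    thus ?thesis
      by (simp add: q_tail_term_def binom_remainder_def powr_minus field_simps del: power_Suc of_nat_Suc)
  qed
  moreover have "(\<lambda>k. of_real (1 - q) powr s * q_tail_term \<nu> 0 q s k) sums
                   (of_real (1 - q) powr s * q_tail \<nu> 0 q s)"
    using assms by (intro sums_mult q_tail_sums) auto
  ultimately show ?thesis
    by (simp add: q_zeta_form_def q_zeta_series_def sums_iff)
qed

lemma of_real_powr_analytic:
  assumes "q > 0"
  shows "(\<lambda>s. complex_of_real q powr (s + c)) analytic_on A"
proof -
  have "(\<lambda>s. complex_of_real q powr (s + c)) holomorphic_on UNIV"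
    using assms by (simp add: of_real_powr_eq_exp) (intro holomorphic_intros)
  thus ?thesis
    using analytic_on_subset[of _ UNIV A] by (simp add: analytic_on_open)
qed

lemma neg_binom_analytic: "(\<lambda>s. neg_binom s k) analytic_on A"
  using holomorphic_neg_binom[of k UNIV] analytic_on_subset[of _ UNIV A] by (simp add: analytic_on_open)

lemma q_tail_analytic:
  assumes "0 < q" "q < 1"
  shows "q_tail \<nu> K q analytic_on {s. Re s > real \<nu> - real K}"
  using q_tail_holomorphic[OF assms] open_Re_greater by (simp add: analytic_on_open)

lemma q_zeta_form_meromorphic:
  assumes "0 < q" "q < 1"
  shows "q_zeta_form \<nu> K q meromorphic_on {s. Re s > real \<nu> - real K}"
proof -
  have [meromorphic_intros]: "(\<lambda>s. complex_of_real q powr (s - of_nat \<nu> + of_nat k)) meromorphic_on A" for k A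
    using of_real_powr_analytic[OF assms(1), of "of_nat k - of_nat \<nu>" A]
    by (simp add: analytic_on_imp_meromorphic_on algebra_simps)
  have [meromorphic_intros]: "(\<lambda>s. complex_of_real (1 - q) powr s) meromorphic_on A" for A
    using of_real_powr_analytic[of "1 - q" 0 A] assms
    by (simp add: analytic_on_imp_meromorphic_on)
  show ?thesis
    unfolding q_zeta_form_def geom_value_def
    by (intro meromorphic_intros analytic_on_imp_meromorphic_on[OF neg_binom_analytic]
              analytic_on_imp_meromorphic_on[OF q_tail_analytic] assms)
qed

lemma q_zeta_form_analytic:
  assumes q: "0 < q" "q < 1" and s: "Re s > real \<nu> - real K"
    and e: "\<And>k. k < K \<Longrightarrow> complex_of_real q powr (s - of_nat \<nu> + of_nat k) \<noteq> 1"
  shows "q_zeta_form \<nu> K q analytic_on {s}"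
proof -
  have [analytic_intros]: "(\<lambda>s. complex_of_real q powr (s - of_nat \<nu> + of_nat k)) analytic_on A" for k A
    using of_real_powr_analytic[OF q(1), of "of_nat k - of_nat \<nu>" A]
    by (simp add: algebra_simps)
  have [analytic_intros]: "(\<lambda>s. complex_of_real (1 - q) powr s) analytic_on A" for A
    using of_real_powr_analytic[of "1 - q" 0 A] q by simp
  have "q_tail \<nu> K q analytic_on {s}"
    by (rule analytic_on_subset[OF q_tail_analytic[OF q]]) (use s in auto)
  thus ?thesis
    unfolding q_zeta_form_def geom_value_def
    by (intro analytic_intros neg_binom_analytic) (use e in auto)
qed

text \<open>
  The order $K = \lfloor \nu - \mathrm{Re}(s) \rfloor + 1$ is the least one whose half-plane contains
  $s$ when $\mathrm{Re}(s) \le \nu$. Since $K$ jumps with $s$, analytic properties are always read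
  off from a form of fixed order that agrees with this function near the point.
\<close>
definition q_zeta_glued :: "nat \<Rightarrow> real \<Rightarrow> complex \<Rightarrow> complex" where
  "q_zeta_glued \<nu> q s = q_zeta_form \<nu> (Suc (nat \<lfloor>real \<nu> - Re s\<rfloor>)) q s"

lemma q_zeta_glued_eq:
  assumes "0 < q" "q < 1" "Re s > real \<nu> - real K"
  shows "q_zeta_glued \<nu> q s = q_zeta_form \<nu> K q s"
proof -
  define L where "L = Suc (nat \<lfloor>real \<nu> - Re s\<rfloor>)"
  have "Re s > real \<nu> - real L"
    unfolding L_def by linarith
  thus ?thesis
    using assms q_zeta_form_mono[of q \<nu> K s L] q_zeta_form_mono[of q \<nu> L s K]
    by (cases "K \<le> L") (auto simp: q_zeta_glued_def L_def)
qed

lemma q_zeta_glued_eventually_eq: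
  assumes "0 < q" "q < 1" "Re s > real \<nu> - real K"
  shows "\<forall>\<^sub>F z in nhds s. q_zeta_glued \<nu> q z = q_zeta_form \<nu> K q z"
proof -
  have "\<forall>\<^sub>F z in nhds s. z \<in> {z. Re z > real \<nu> - real K}"
    using assms by (intro eventually_nhds_in_open open_Re_greater) auto
  thus ?thesis
    by eventually_elim (use assms q_zeta_glued_eq in auto)
qed

lemma q_zeta_glued_meromorphic:
  assumes "0 < q" "q < 1"
  shows "q_zeta_glued \<nu> q meromorphic_on UNIV"
  unfolding meromorphic_on_meromorphic_at[of _ UNIV]
proof
  fix s :: complex
  define K where "K = Suc (nat \<lfloor>real \<nu> - Re s\<rfloor>)"
  have K: "Re s > real \<nu> - real K"
    unfolding K_def by linarith
  have "q_zeta_form \<nu> K q meromorphic_on {s}"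
    by (rule meromorphic_on_subset[OF q_zeta_form_meromorphic[OF assms]]) (use K in auto)
  moreover have "\<forall>\<^sub>F z in at s. q_zeta_glued \<nu> q z = q_zeta_form \<nu> K q z"
    using q_zeta_glued_eventually_eq[OF assms K] by (simp add: eventually_at_filter eventually_mono)
  ultimately show "q_zeta_glued \<nu> q meromorphic_on {s}"
    using meromorphic_on_cong[of "{s}" "q_zeta_glued \<nu> q" "q_zeta_form \<nu> K q"] by auto
qed

lemma q_zeta_glued_analytic:
  assumes q: "0 < q" "q < 1" and s: "Re s > real \<nu> - real K"
    and e: "\<And>k. k < K \<Longrightarrow> complex_of_real q powr (s - of_nat \<nu> + of_nat k) \<noteq> 1"
  shows "q_zeta_glued \<nu> q analytic_on {s}"
  using q_zeta_form_analytic[OF assms] analytic_at_cong[OF q_zeta_glued_eventually_eq[OF q s] refl]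
  by simp

text \<open>
  The glued function still carries the values that division by zero produces at the points with
  $q^{w_k} = 1$, hence the normalisation.
\<close>
lemma q_zeta_eq_remove_sings:
  assumes q: "0 < q" "q < 1"
  shows "q_zeta \<nu> q = remove_sings (q_zeta_glued \<nu> q)"
  unfolding q_zeta_def
proof (rule the_equality, intro conjI allI impI)
  show nice: "remove_sings (q_zeta_glued \<nu> q) nicely_meromorphic_on UNIV"
    by (intro remove_sings_nicely_meromorphic q_zeta_glued_meromorphic q)
  show ser: "remove_sings (q_zeta_glued \<nu> q) s = q_zeta_series \<nu> q s" if "Re s > real \<nu>" for s
    using that q q_zeta_glued_analytic[OF q, of \<nu> 0 s]
    by (simp add: q_zeta_glued_eq[where K = 0] q_zeta_form_0)
  fix f assume f: "f nicely_meromorphic_on UNIV \<and> (\<forall>s. Re s > real \<nu> \<longrightarrow> f s = q_zeta_series \<nu> q s)"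
  show "f = remove_sings (q_zeta_glued \<nu> q)"
  proof (rule nicely_meromorphic_eqI[of _ _ "{s. Re s > real \<nu>}"])
    have "of_nat (Suc \<nu>) \<in> {s. Re s > real \<nu>}" by simp
    thus "{s. Re s > real \<nu>} \<noteq> {}" by blast
  qed (use f nice ser open_Re_greater in auto)
qed

text \<open>
  Besides the value, the absence of a pole is recorded: it is needed to know that a sequence of
  parameters $q$ is admissible for the crystal limit.
\<close>
lemma q_zeta_regular_point:
  assumes q: "0 < q" "q < 1" and s: "Re s > real \<nu> - real K"
    and e: "\<And>k. k < K \<Longrightarrow> complex_of_real q powr (s - of_nat \<nu> + of_nat k) \<noteq> 1"
  shows "q_zeta \<nu> q s = q_zeta_form \<nu> K q s" "q \<in> q_zeta_domain \<nu> s"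
proof -
  have an: "q_zeta_glued \<nu> q analytic_on {s}"
    by (rule q_zeta_glued_analytic[OF assms])
  show "q_zeta \<nu> q s = q_zeta_form \<nu> K q s"
    using an by (simp add: q_zeta_eq_remove_sings[OF q] q_zeta_glued_eq[OF q s])
  have "q_zeta \<nu> q analytic_on {s}"
    using an analytic_at_cong[OF eventually_remove_sings_eq_nhds[OF an] refl]
    by (simp add: q_zeta_eq_remove_sings[OF q])
  thus "q \<in> q_zeta_domain \<nu> s"
    using q analytic_at_imp_no_pole by (auto simp: q_zeta_domain_def)
qed

lemma q_zeta_removable_point:
  assumes q: "0 < q" "q < 1" and s: "Re s > real \<nu> - real K"
    and L: "q_zeta_form \<nu> K q \<midarrow>s\<rightarrow> L"
  shows "q_zeta \<nu> q s = L"
proof -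
  have "\<forall>\<^sub>F z in at s. q_zeta_glued \<nu> q z = q_zeta_form \<nu> K q z"
    using q_zeta_glued_eventually_eq[OF q s] by (simp add: eventually_at_filter eventually_mono)
  hence "q_zeta_glued \<nu> q \<midarrow>s\<rightarrow> L"
    using L by (simp cong: filterlim_cong)
  thus ?thesis
    by (simp add: q_zeta_eq_remove_sings[OF q] remove_sings_eqI)
qed


section \<open>The limit of the continued function as $q$ tends to $0$\<close>

lemma tendsto_of_real_powr_0:
  assumes "Re w > 0"
  shows "((\<lambda>q. complex_of_real q powr w) \<longlongrightarrow> 0) (at_right 0)"
proof (rule tendsto_norm_zero_cancel)
  have "((\<lambda>q. q powr Re w) \<longlongrightarrow> 0 powr Re w) (at_right (0::real))"
    using assms by (intro tendsto_powr2 tendsto_intros)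
                   (auto simp: eventually_at_filter)
  hence "((\<lambda>q. q powr Re w) \<longlongrightarrow> 0) (at_right (0::real))"
    by simp
  moreover have "\<forall>\<^sub>F q in at_right 0. norm (complex_of_real q powr w) = q powr Re w"
    using eventually_at_right_less[of "0::real"] by eventually_elim (simp add: norm_of_real_powr)
  ultimately show "((\<lambda>q. norm (complex_of_real q powr w)) \<longlongrightarrow> 0) (at_right 0)"
    using assms by (simp cong: filterlim_cong)
qed

lemma tendsto_geom_value_powr:
  assumes "Re w < 0"
  shows "((\<lambda>q. geom_value (complex_of_real q powr w)) \<longlongrightarrow> -1) (at_right 0)"
proof -
  have "((\<lambda>q. 1 / (complex_of_real q powr (- w) - 1)) \<longlongrightarrow> 1 / (0 - 1)) (at_right 0)"
    using assms by (intro tendsto_intros tendsto_of_real_powr_0) auto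
  moreover have "\<forall>\<^sub>F q in at_right 0. 1 / (complex_of_real q powr (- w) - 1) = geom_value (of_real q powr w)"
    using eventually_at_right_less[of "0::real"]
  proof eventually_elim
    case (elim q)
    hence "complex_of_real q powr w \<noteq> 0" by simp
    thus ?case
      by (simp add: geom_value_def powr_minus divide_simps)
  qed
  ultimately show ?thesis
    by (simp cong: filterlim_cong)
qed

lemma tendsto_q_tail:
  assumes s: "Re s > real \<nu> - real K"
  shows "((\<lambda>q. q_tail \<nu> K q s) \<longlongrightarrow> 0) (at_right 0)"
proof -
  define a where "a = Re s - real \<nu> + real K"
  have a: "a > 0" using s by (simp add: a_def)
  have half: "0 < (1/2 :: real)" "(1/2 :: real) < 1" by auto
  obtain C where C: "\<And>q z. norm z \<le> norm s \<Longrightarrow> 0 < q \<Longrightarrow> q \<le> 1/2 \<Longrightarrow> Re z > real \<nu> - real K \<Longrightarrow>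
       summable (q_tail_term \<nu> K q z) \<and>
       norm (q_tail \<nu> K q z) \<le> C * (q powr (Re z - real \<nu> + real K) / (1 - q powr (Re z - real \<nu> + real K)))"
    using q_tail_summable_and_bound[OF half] by metis
  show ?thesis
  proof (rule Lim_null_comparison)
    have "\<forall>\<^sub>F q in at_right (0::real). q \<in> {0<..<1/2}"
      by (intro eventually_at_right_real) auto
    thus "\<forall>\<^sub>F q in at_right 0. norm (q_tail \<nu> K q s) \<le> C * (q powr a / (1 - q powr a))"
    proof eventually_elim
      case (elim q)
      thus ?case
        using C[of s q] s by (simp add: a_def)
    qed
    have "((\<lambda>q. q powr a) \<longlongrightarrow> 0 powr a) (at_right (0::real))"
      using a by (intro tendsto_powr2 tendsto_intros) (auto simp: eventually_at_filter)
    hence "((\<lambda>q. q powr a) \<longlongrightarrow> 0) (at_right (0::real))"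
      by simp
    hence "((\<lambda>q. C * (q powr a / (1 - q powr a))) \<longlongrightarrow> C * (0 / (1 - 0))) (at_right (0::real))"
      by (intro tendsto_intros) auto
    thus "((\<lambda>q. C * (q powr a / (1 - q powr a))) \<longlongrightarrow> 0) (at_right (0::real))"
      by simp
  qed
qed

text \<open>
  The parameter $q$ is allowed to run along an arbitrary filter, so that the result applies both
  to the full limit and to special sequences of parameters.
\<close>
lemma tendsto_q_zeta_form:
  assumes Q: "filterlim Q (at_right 0) F" and s: "Re s > real \<nu> - real K"
    and g: "\<And>k. k < K \<Longrightarrow>
              ((\<lambda>x. geom_value (of_real (Q x) powr (s - of_nat \<nu> + of_nat k))) \<longlongrightarrow> g k) F"
  shows "((\<lambda>x. q_zeta_form \<nu> K (Q x) s) \<longlongrightarrow> (\<Sum>k<K. neg_binom s k * g k)) F"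
proof -
  have "((\<lambda>q. exp (s * of_real (ln (1 - q)))) \<longlongrightarrow> exp (s * of_real (ln (1 - 0)))) (at_right (0::real))"
    by (intro tendsto_intros) auto
  moreover have "\<forall>\<^sub>F q in at_right (0::real). q \<in> {0<..<1}"
    by (intro eventually_at_right_real) auto
  hence "\<forall>\<^sub>F q in at_right (0::real). exp (s * of_real (ln (1 - q))) = of_real (1 - q) powr s"
    by eventually_elim (simp add: of_real_powr_eq_exp del: of_real_diff)
  ultimately have one: "((\<lambda>q. of_real (1 - q) powr s) \<longlongrightarrow> 1) (at_right (0::real))"
    by (simp cong: filterlim_cong del: of_real_diff)
  have "((\<lambda>x. q_zeta_form \<nu> K (Q x) s) \<longlongrightarrow> 1 * ((\<Sum>k<K. neg_binom s k * g k) + 0)) F"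
    unfolding q_zeta_form_def
    by (intro tendsto_intros g filterlim_compose[OF one Q] filterlim_compose[OF tendsto_q_tail[OF s] Q]) auto
  thus ?thesis by simp
qed

section \<open>Crystal values off and on the lines of poles\<close>

lemma q_zeta_domain_subset: "q_zeta_domain \<nu> s \<subseteq> {0<..<1}"
  by (auto simp: q_zeta_domain_def)

lemma crystal_filter:
  shows "at 0 within q_zeta_domain \<nu> s \<le> at_right (0::real)"
    and "\<forall>\<^sub>F q in at 0 within q_zeta_domain \<nu> s. 0 < q \<and> q < 1"
  using q_zeta_domain_subset[of \<nu> s]
  by (auto intro!: at_le simp: eventually_at_filter subset_iff)

lemma has_crystal_zeta_unique:
  assumes "has_crystal_zeta \<nu> s L"
    and "\<And>q. 0 < q \<Longrightarrow> q < 1 \<Longrightarrow> q_zeta \<nu> q s = f q"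
    and "(f \<longlongrightarrow> L') (at_right 0)"
  shows "L = L'"
proof -
  define F where "F = at 0 within q_zeta_domain \<nu> s"
  have "F \<noteq> bot" "((\<lambda>q. q_zeta \<nu> q s) \<longlongrightarrow> L) F"
    using assms(1) by (auto simp: has_crystal_zeta_def F_def trivial_limit_within)
  moreover have "\<forall>\<^sub>F q in F. q_zeta \<nu> q s = f q"
    using crystal_filter(2)[of \<nu> s] unfolding F_def by eventually_elim (use assms(2) in auto)
  moreover have "(f \<longlongrightarrow> L') F"
    using assms(3) crystal_filter(1) unfolding F_def by (rule filterlim_mono[OF _ order_refl])
  ultimately show ?thesis
    using tendsto_unique[of F f L L'] by (simp cong: filterlim_cong)
qed

text \<open>
  All $w_k$ with $k \le m$ have negative real part, so $|q^{w_k}| > 1$: no term has a pole, and every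
  $g(q^{w_k})$ tends to $-1$. The sum of the coefficients telescopes.
\<close>
lemma crystal_zeta_generic:
  assumes s: "has_crystal_zeta \<nu> s L" and m: "real m < real \<nu> - Re s" "real \<nu> - Re s < real m + 1"
  shows "L = - neg_binom (s + 1) m"
proof -
  have Re: "Re (s - of_nat \<nu> + of_nat k) < 0" if "k < Suc m" for k
    using that m by (simp add: less_Suc_eq_le)
  have "q_zeta \<nu> q s = q_zeta_form \<nu> (Suc m) q s" if q: "0 < q" "q < 1" for q
  proof (rule q_zeta_regular_point(1)[OF q])
    fix k assume "k < Suc m"
    have "norm (complex_of_real q powr (s - of_nat \<nu> + of_nat k)) \<noteq> 1"
      using Re[OF \<open>k < Suc m\<close>] q by (simp add: norm_of_real_powr)
    thus "complex_of_real q powr (s - of_nat \<nu> + of_nat k) \<noteq> 1"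
      by (metis norm_one)
  qed (use m in auto)
  moreover have "((\<lambda>q. q_zeta_form \<nu> (Suc m) q s) \<longlongrightarrow> (\<Sum>k<Suc m. neg_binom s k * (-1))) (at_right 0)"
    using m by (intro tendsto_q_zeta_form[where Q = "\<lambda>q. q"] tendsto_geom_value_powr Re filterlim_ident) auto
  ultimately have "L = (\<Sum>k<Suc m. neg_binom s k * (-1))"
    by (rule has_crystal_zeta_unique[OF s])
  thus ?thesis
    by (simp add: sum_negf lessThan_Suc_atMost sum_neg_binom del: sum.lessThan_Suc)
qed

text \<open>
  The point $q^{it} = e^{i t \log q}$ moves round the unit circle with period $2\pi/|t|$ in $\log q$.
\<close>
lemma powr_circle_sequence:
  fixes t :: real and c :: complex
  assumes t: "t \<noteq> 0" and c: "norm c = 1"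
  obtains Q :: "nat \<Rightarrow> real" where "filterlim Q (at_right 0) sequentially"
    "\<And>j. complex_of_real (Q j) powr (\<i> * of_real t) = c"
proof
  define Q where "Q j = exp (Arg c / t - 2 * pi / \<bar>t\<bar> * real j)" for j
  have "filterlim (\<lambda>j. 2 * pi / \<bar>t\<bar> * real j) at_top sequentially"
    using t by (intro filterlim_tendsto_pos_mult_at_top[OF tendsto_const] filterlim_real_sequentially) auto
  hence "filterlim (\<lambda>j. - Arg c / t + 2 * pi / \<bar>t\<bar> * real j) at_top sequentially"
    by (rule filterlim_tendsto_add_at_top[OF tendsto_const])
  hence "filterlim (\<lambda>j. Arg c / t - 2 * pi / \<bar>t\<bar> * real j) at_bot sequentially"
    by (simp add: filterlim_uminus_at_bot)
  hence "(Q \<longlongrightarrow> 0) sequentially"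
    unfolding Q_def by (rule filterlim_compose[OF exp_at_bot])
  thus "filterlim Q (at_right 0) sequentially"
    by (auto simp: filterlim_at Q_def)
  fix j
  have "complex_of_real (Q j) powr (\<i> * of_real t) = exp (\<i> * of_real (t * (Arg c / t - 2 * pi / \<bar>t\<bar> * real j)))"
    by (simp add: of_real_powr_eq_exp Q_def mult_ac del: of_real_diff)
  \<comment> \<open>The sign makes $\log q$ decrease by a full period at each step, whatever the sign of $t$.\<close>
  also have "t * (Arg c / t - 2 * pi / \<bar>t\<bar> * real j) = Arg c + of_int (- (if t > 0 then 1 else -1) * int j) * (2 * pi)"
    using t by (auto simp: field_simps)
  also have "exp (\<i> * of_real \<dots>) = exp (\<i> * of_real (Arg c))"
    by (subst exp_eq) (auto simp: algebra_simps intro!: exI[of _ "- (if t > 0 then 1 else -1) * int j"])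
  also have "\<dots> = c"
    using c Arg_eq[of c] by (cases "c = 0") auto
  finally show "complex_of_real (Q j) powr (\<i> * of_real t) = c" .
qed

text \<open>
  Along the parameters with $q^{w_m} = c$ the zeta values tend to $A + b_m(s)\, g(c)$ with $A$
  independent of $c$. Comparing two points $c$ of the unit circle would give $b_m(s) = 0$, which is
  impossible because the zeros of $b_m$ are real.
\<close>
lemma crystal_zeta_critical_line:
  assumes s: "has_crystal_zeta \<nu> s L" and Re: "Re s = real \<nu> - real m" and Im: "Im s \<noteq> 0"
  shows False
proof -
  have w: "s - of_nat \<nu> + of_nat m = \<i> * of_real (Im s)"
    using Re by (simp add: complex_eq_iff)
  have lim: "L = (\<Sum>k<m. neg_binom s k * (-1)) + neg_binom s m * geom_value c"
    if c: "norm c = 1" "c \<noteq> 1" for c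
  proof -
    obtain Q :: "nat \<Rightarrow> real" where Q: "filterlim Q (at_right 0) sequentially"
      "\<And>j. complex_of_real (Q j) powr (\<i> * of_real (Im s)) = c"
      using powr_circle_sequence[OF Im c(1)] by metis
    have "\<forall>\<^sub>F q in at_right (0::real). q \<in> {0<..<1}"
      by (intro eventually_at_right_real) auto
    from eventually_compose_filterlim[OF this Q(1)] have Q01: "\<forall>\<^sub>F j in sequentially. 0 < Q j \<and> Q j < 1"
      by simp
    have reg: "q_zeta \<nu> (Q j) s = q_zeta_form \<nu> (Suc m) (Q j) s \<and> Q j \<in> q_zeta_domain \<nu> s"
      if q: "0 < Q j \<and> Q j < 1" for j
    proof -
      have ne: "complex_of_real (Q j) powr (s - of_nat \<nu> + of_nat k) \<noteq> 1" if "k < Suc m" for k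
      proof (cases "k = m")
        case True
        thus ?thesis using Q(2)[of j] c by (simp add: w)
      next
        case False
        hence "norm (complex_of_real (Q j) powr (s - of_nat \<nu> + of_nat k)) \<noteq> 1"
          using that q by (simp add: norm_of_real_powr Re)
        thus ?thesis by (metis norm_one)
      qed
      have "Re s > real \<nu> - real (Suc m)" using Re by simp
      from q_zeta_regular_point[OF _ _ this ne] show ?thesis using q by auto
    qed
    have "filterlim Q (at 0 within q_zeta_domain \<nu> s) sequentially"
      unfolding filterlim_at
    proof
      show "\<forall>\<^sub>F j in sequentially. Q j \<in> q_zeta_domain \<nu> s \<and> Q j \<noteq> 0"
        using Q01 by eventually_elim (use reg in auto)
      show "(Q \<longlongrightarrow> 0) sequentially"
        using Q(1) by (simp add: filterlim_at)
    qed
    hence "((\<lambda>j. q_zeta \<nu> (Q j) s) \<longlongrightarrow> L) sequentially"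
      using s by (auto simp: has_crystal_zeta_def intro: filterlim_compose)
    moreover have "\<forall>\<^sub>F j in sequentially. q_zeta \<nu> (Q j) s = q_zeta_form \<nu> (Suc m) (Q j) s"
      using Q01 by eventually_elim (use reg in auto)
    ultimately have "((\<lambda>j. q_zeta_form \<nu> (Suc m) (Q j) s) \<longlongrightarrow> L) sequentially"
      by (simp cong: filterlim_cong)
    moreover have "((\<lambda>j. q_zeta_form \<nu> (Suc m) (Q j) s) \<longlongrightarrow>
        (\<Sum>k<Suc m. neg_binom s k * (if k = m then geom_value c else -1))) sequentially"
    proof (rule tendsto_q_zeta_form[OF Q(1)])
      fix k assume "k < Suc m"
      show "((\<lambda>j. geom_value (of_real (Q j) powr (s - of_nat \<nu> + of_nat k))) \<longlongrightarrow>
              (if k = m then geom_value c else -1)) sequentially"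
      proof (cases "k = m")
        case True
        thus ?thesis by (simp add: w Q(2))
      next
        case False
        hence "Re (s - of_nat \<nu> + of_nat k) < 0"
          using \<open>k < Suc m\<close> Re by simp
        thus ?thesis
          using filterlim_compose[OF tendsto_geom_value_powr Q(1)] False by simp
      qed
    qed (use Re in auto)
    ultimately have "L = (\<Sum>k<Suc m. neg_binom s k * (if k = m then geom_value c else -1))"
      using LIMSEQ_unique by blast
    thus ?thesis by simp
  qed
  have "neg_binom s m * geom_value (-1) = neg_binom s m * geom_value \<i>"
  proof -
    have "L = (\<Sum>k<m. neg_binom s k * (-1)) + neg_binom s m * geom_value (-1)"
      by (rule lim) auto
    moreover have "L = (\<Sum>k<m. neg_binom s k * (-1)) + neg_binom s m * geom_value \<i>"
      by (rule lim) auto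
    ultimately show ?thesis
      by (metis add_left_cancel)
  qed
  moreover have "geom_value (-1) \<noteq> geom_value \<i>"
    by (simp add: geom_value_def complex_eq_iff Re_divide Im_divide)
  ultimately have "neg_binom s m = 0"
    by simp
  thus False
    using Im by (auto simp: neg_binom_eq_0_iff)
qed

section \<open>The crystal value at the origin\<close>

lemma analytic_at_tendsto: "f analytic_on {z} \<Longrightarrow> f \<midarrow>z\<rightarrow> f z"
  by (rule isContD[OF analytic_at_imp_isCont])

text \<open>
  At $s = 0$ all coefficients $b_k$ with $k \ge 1$ vanish, and so does the remainder. Besides $k = 0$,
  only $k = \nu$ survives: there $w_\nu = s$, so $g(q^{w_\nu})$ has a simple pole, and the simple zero
  $b_\nu(s) \sim s/\nu$ meets $g(q^s) \sim -1/(s \log q)$.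
\<close>
lemma q_zeta_at_0:
  assumes q: "0 < q" "q < 1" and \<nu>: "\<nu> > 0"
  shows "q_zeta \<nu> q 0 = geom_value (of_real q powr (- of_nat \<nu>)) - 1 / (of_nat \<nu> * of_real (ln q))"
proof (rule q_zeta_removable_point[OF q, where K = "Suc \<nu>"])
  obtain p where p: "\<nu> = Suc p" using \<nu> by (cases \<nu>) auto
  have powr: "(\<lambda>z. complex_of_real r powr z) \<midarrow>0\<rightarrow> 1" if "r > 0" for r
    using analytic_at_tendsto[OF of_real_powr_analytic[OF that, of 0 "{0}"]] that
    by simp
  have nb: "(\<lambda>z::complex. neg_binom z k) \<midarrow>0\<rightarrow> neg_binom 0 k" for k :: nat
    by (rule analytic_at_tendsto[OF neg_binom_analytic])
  have summand: "(\<lambda>z. neg_binom z k * geom_value (of_real q powr (z - of_nat \<nu> + of_nat k)))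
      \<midarrow>0\<rightarrow> neg_binom 0 k * geom_value (of_real q powr (0 - of_nat \<nu> + of_nat k))" if "k < \<nu>" for k
  proof -
    have "norm (complex_of_real q powr (0 - of_nat \<nu> + of_nat k)) \<noteq> 1"
      using that q by (simp add: norm_of_real_powr)
    hence ne: "complex_of_real q powr (0 - of_nat \<nu> + of_nat k) \<noteq> 1"
      by (metis norm_one)
    have pw: "(\<lambda>z. complex_of_real q powr (z - of_nat \<nu> + of_nat k)) \<midarrow>0\<rightarrow> of_real q powr (0 - of_nat \<nu> + of_nat k)"
      using analytic_at_tendsto[OF of_real_powr_analytic[OF q(1), of "of_nat k - of_nat \<nu>"], of 0]
      by (simp add: algebra_simps)
    thus ?thesis
      unfolding geom_value_def
      by (intro tendsto_mult tendsto_divide tendsto_diff tendsto_const nb pw) (use ne in simp)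
  qed
  have tail: "q_tail \<nu> (Suc \<nu>) q \<midarrow>0\<rightarrow> 0"
  proof -
    have "q_tail \<nu> (Suc \<nu>) q analytic_on {0}"
      by (rule analytic_on_subset[OF q_tail_analytic[OF q]]) auto
    hence "q_tail \<nu> (Suc \<nu>) q \<midarrow>0\<rightarrow> q_tail \<nu> (Suc \<nu>) q 0"
      by (rule analytic_at_tendsto)
    moreover have "binom_remainder (Suc \<nu>) 0 x = 0" if "x < 1" for x
      using that by (simp add: binom_remainder_def neg_binom_zero_left if_distrib if_distribR
                      del: sum.lessThan_Suc cong: if_cong)
    hence "q_tail \<nu> (Suc \<nu>) q 0 = 0"
      using q power_Suc_less_one[of q] by (simp add: q_tail_def q_tail_term_def)
    ultimately show ?thesis by simp
  qed
  have sing: "(\<lambda>z. neg_binom z \<nu> * geom_value (of_real q powr z)) \<midarrow>0\<rightarrow> - 1 / (of_nat \<nu> * of_real (ln q))"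
  proof -
    have lnq: "complex_of_real (ln q) \<noteq> 0" using q by simp
    have ne: "1 + complex_of_nat p \<noteq> 0"
      using of_nat_neq_0[of p, where ?'a = complex] by (simp only: of_nat_Suc not_False_eq_True)
    \<comment> \<open>The derivative of $q^z$ at $0$ gives $1 - q^z \sim -z \log q$, hence the residue $-1/\log q$ of $g(q^z)$.\<close>
    have "((\<lambda>z. exp (z * complex_of_real (ln q))) has_field_derivative of_real (ln q)) (at 0)"
      by (auto intro!: derivative_eq_intros)
    hence quot: "(\<lambda>z. (complex_of_real q powr z - 1) / z) \<midarrow>0\<rightarrow> of_real (ln q)"
      using q by (simp add: has_field_derivative_iff of_real_powr_eq_exp)
    have "(\<lambda>z. pochhammer (z + 1) p / fact (Suc p) * complex_of_real q powr z *
             (- inverse ((complex_of_real q powr z - 1) / z))) \<midarrow>0\<rightarrow>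
           pochhammer (0 + 1) p / fact (Suc p) * 1 * (- inverse (of_real (ln q)))"
      unfolding pochhammer_prod
      by (intro tendsto_mult tendsto_divide tendsto_prod tendsto_add tendsto_minus tendsto_inverse
                tendsto_const tendsto_ident_at quot lnq powr q) (use ne in auto)
    also have "(\<lambda>z. pochhammer (z + 1) p / fact (Suc p) * complex_of_real q powr z *
             (- inverse ((complex_of_real q powr z - 1) / z))) = (\<lambda>z. neg_binom z \<nu> * geom_value (of_real q powr z))"
      by (rule ext) (simp add: p neg_binom_def geom_value_def pochhammer_rec divide_simps, simp add: algebra_simps)
    also have "pochhammer (0 + 1) p / fact (Suc p) * 1 * (- inverse (complex_of_real (ln q))) =
               - 1 / (of_nat \<nu> * of_real (ln q))"
      using lnq ne by (simp add: p pochhammer_fact [symmetric] divide_simps)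
    finally show ?thesis .
  qed
  have sing': "(\<lambda>z. neg_binom z \<nu> * geom_value (of_real q powr (z - of_nat \<nu> + of_nat \<nu>)))
      \<midarrow>0\<rightarrow> - 1 / (of_nat \<nu> * of_real (ln q))"
    using sing by simp
  have "q_zeta_form \<nu> (Suc \<nu>) q \<midarrow>0\<rightarrow>
     1 * (((\<Sum>k<\<nu>. neg_binom 0 k * geom_value (of_real q powr (0 - of_nat \<nu> + of_nat k)))
           + - 1 / (of_nat \<nu> * of_real (ln q))) + 0)"
    unfolding q_zeta_form_def sum.lessThan_Suc
    by (rule tendsto_mult[OF powr tendsto_add[OF tendsto_add[OF tendsto_sum[OF summand] sing'] tail]])
       (use q in auto)
  also have "1 * (((\<Sum>k<\<nu>. neg_binom 0 k * geom_value (of_real q powr (0 - of_nat \<nu> + of_nat k)))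
           + - 1 / (of_nat \<nu> * of_real (ln q))) + 0) =
     geom_value (of_real q powr (- of_nat \<nu>)) - 1 / (of_nat \<nu> * of_real (ln q))"
    using \<nu> by (simp add: neg_binom_zero_left if_distrib if_distribR cong: if_cong)
  finally show "q_zeta_form \<nu> (Suc \<nu>) q \<midarrow>0\<rightarrow>
     geom_value (of_real q powr (- of_nat \<nu>)) - 1 / (of_nat \<nu> * of_real (ln q))" .
qed auto

lemma crystal_zeta_at_0:
  assumes "has_crystal_zeta \<nu> 0 L" "\<nu> > 0"
  shows "L = -1"
proof (rule has_crystal_zeta_unique[OF assms(1)])
  show "q_zeta \<nu> q 0 = geom_value (of_real q powr (- of_nat \<nu>)) - of_real (1 / (real \<nu> * ln q))"
    if "0 < q" "q < 1" for q
    using q_zeta_at_0[OF that assms(2)] by simp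
  have "filterlim (\<lambda>q. real \<nu> * ln q) at_bot (at_right 0)"
    using assms(2) by (intro filterlim_tendsto_pos_mult_at_bot[OF tendsto_const] ln_at_0) auto
  hence "((\<lambda>q. 1 / (real \<nu> * ln q)) \<longlongrightarrow> 0) (at_right 0)"
    by (intro tendsto_divide_0[OF tendsto_const] filterlim_at_bot_imp_at_infinity)
  hence "((\<lambda>q. geom_value (of_real q powr (- of_nat \<nu>)) - of_real (1 / (real \<nu> * ln q))) \<longlongrightarrow> -1 - of_real 0)
           (at_right 0)"
    using assms(2) by (intro tendsto_diff tendsto_of_real tendsto_geom_value_powr) auto
  thus "((\<lambda>q. geom_value (of_real q powr (- of_nat \<nu>)) - of_real (1 / (real \<nu> * ln q))) \<longlongrightarrow> -1) (at_right 0)"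
    by simp
qed

section \<open>Zeros of the crystal zeta function\<close>

theorem corollary2p11:
  fixes \<nu> :: nat and s :: complex
  assumes "\<nu> > 0"
    and "has_crystal_zeta \<nu> s 0"
    and "Re s \<le> real \<nu>"
    and "s \<notin> of_nat ` {1..\<nu>}"
  shows "\<exists>m::int. m < 0 \<and> s = of_int m"
proof -
  define m where "m = nat \<lfloor>real \<nu> - Re s\<rfloor>"
  have m: "real m \<le> real \<nu> - Re s" "real \<nu> - Re s < real m + 1"
    using assms(3) unfolding m_def by linarith+
  show ?thesis
  proof (cases "real m = real \<nu> - Re s")
    case False
    hence "neg_binom (s + 1) m = 0"
      using crystal_zeta_generic[OF assms(2), of m] m by simp
    then obtain k where "s + 1 = - of_nat k"
      by (auto simp: neg_binom_eq_0_iff)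
    hence "s = of_int (- int k - 1)"
      by (simp add: eq_diff_eq)
    thus ?thesis
      by (intro exI[of _ "- int k - 1"]) auto
  next
    case True
    hence Re: "Re s = real \<nu> - real m" by simp
    have "Im s = 0"
      using crystal_zeta_critical_line[OF assms(2) Re] by blast
    hence s: "s = of_int (int \<nu> - int m)"
      using Re by (simp add: complex_eq_iff)
    have "\<not> int \<nu> - int m > 0"
    proof
      assume pos: "int \<nu> - int m > 0"
      hence "s = of_nat (\<nu> - m)" "\<nu> - m \<in> {1..\<nu>}"
        using s by auto
      thus False using assms(4) by blast
    qed
    moreover have "int \<nu> - int m \<noteq> 0"
      using crystal_zeta_at_0[of \<nu> 0] assms(1,2) s by auto
    ultimately show ?thesis
      using s by (intro exI[of _ "int \<nu> - int m"]) auto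
  qed
qed

end
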